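(* Let $f\colon X\to\mathbb{R}$ be a filter on a Lefschetz complex. Then the shallow pairs of $f$ are exactly the minimal elements of its depth poset: $$\mathrm{SH}(f)=\mathrm{Min}(\mathcal{D}_f).$$
   Context: Fix a field $\mathbb{F}$. A Lefschetz complex is a triple $(X,\dim,\kappa)$ with $X$ a finite set (of cells), $\dim\colon X\to\mathbb{Z}$, and an incidence map $\kappa\colon X\times X\to\mathbb{F}$ such that $\sum_{y\in X}\kappa(z,y)\kappa(y,x)=0$ for all $z,x\in X$, and $\kappa(y,x)\neq 0$ only if $\dim y=\dim x+1$. If $\kappa(y,x)\ne 0$, then $x$ is a facet of $y$ and $y$ is a cofacet of $x$. A filter on $X$ is an injective map $f\colon X\to\mathbb{R}$ with $f(x)<f(y)$ whenever $x$ is a facet of $y$. Birth-death pairs: order $X$ by $f$ and let $\Delta$ be the matrix with rows and columns indexed by $X$ in this order, $\Delta[x,y]=\kappa(y,x)$. A reduced form of $\Delta$ is a matrix $R=\Delta\cdot V$ with $V-\mathrm{Id}$ strictly upper triangular and such that the pivots (lowest non-zero entries) of the non-zero columns of $R$ lie in pairwise different rows. $\mathrm{BD}(f)$ is the set of pairs $(s,t)\in X\times X$ such that column $t$ of $R$ is non-zero and its pivot is in row $s$; this does not depend on the choice of $R$. Shallow pairs: $\mathrm{SH}(f)$ is the set of pairs $(s,t)$ such that $s$ is a facet of $t$, $f(x)\le f(s)$ for all facets $x$ of $t$, and $f(y)\ge f(t)$ for all cofacets $y$ of $s$. One has $\mathrm{SH}(f)\subseteq\mathrm{BD}(f)$.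 Cancellation: if $s$ is a facet of $t$, the quotient of $X$ by $(s,t)$ is the Lefschetz complex with cells $X\setminus\{s,t\}$, restricted dimension map, and incidence map $\kappa'(y,x)=\kappa(y,x)-\kappa(t,s)^{-1}\kappa(y,s)\kappa(t,x)$. If $(s,t)\in\mathrm{SH}(f)$, the restriction of $f$ is a filter on the quotient. Shallow orders: let $n=\#\mathrm{BD}(f)$. A shallow (cancellation) order of $f$ is an enumeration $\Phi=(\varphi_1,\dots,\varphi_n)$ of $\mathrm{BD}(f)$ such that, setting $X_0=X$, $f_0=f$, and letting $X_i$ be the quotient of $X_{i-1}$ by $\varphi_i$ and $f_i=f|_{X_i}$, one has $\varphi_i\in\mathrm{SH}(f_{i-1})$ for $i=1,\dots,n$. It is identified with the linear order $\varphi_i\le_\Phi\varphi_j\iff i\le j$. Depth poset: $\mathcal{D}_f$ is the partial order on $\mathrm{BD}(f)$ that is the intersection of all shallow orders of $f$: $\chi\le_f\xi$ iff $\chi\le_\Phi\xi$ for every shallow order $\Phi$ of $f$. $\mathrm{Min}(\mathcal{D}_f)$ is the set of elements of $\mathrm{BD}(f)$ that are minimal in $\mathcal{D}_f$. *)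

theory Defs
  imports Complex_Main
begin

text \<open>
  The dimension and incidence maps are total functions on the type of cells, but only their
  values on the finite set \<open>cells X\<close> matter: every definition below is relativised to it.
  The same holds for filters, so that the restriction of a filter to a quotient is
  represented by the same function.
\<close>

record ('a, 'k) cell_complex =
  cells :: "'a set"
  cdim :: "'a \<Rightarrow> int"
  incid :: "'a \<Rightarrow> 'a \<Rightarrow> 'k"

definition lefschetz_complex :: "('a, 'k::field) cell_complex \<Rightarrow> bool" where
  "lefschetz_complex X \<longleftrightarrow>
     finite (cells X) \<and>
     (\<forall>z\<in>cells X. \<forall>x\<in>cells X. (\<Sum>y\<in>cells X. incid X z y * incid X y x) = 0) \<and>
     (\<forall>y\<in>cells X. \<forall>x\<in>cells X. incid X y x \<noteq> 0 \<longrightarrow> cdim X y = cdim X x + 1)"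

definition facet :: "('a, 'k::field) cell_complex \<Rightarrow> 'a \<Rightarrow> 'a \<Rightarrow> bool" where
  "facet X x y \<longleftrightarrow> x \<in> cells X \<and> y \<in> cells X \<and> incid X y x \<noteq> 0"

definition filter_on :: "('a, 'k::field) cell_complex \<Rightarrow> ('a \<Rightarrow> real) \<Rightarrow> bool" where
  "filter_on X f \<longleftrightarrow>
     inj_on f (cells X) \<and> (\<forall>x y. facet X x y \<longrightarrow> f x < f y)"


text \<open>
  Matrices are functions of a row and a column, both ranging over \<open>cells X\<close>. The order of
  rows and columns is the one given by the values of \<open>f\<close>, so ``lowest'' means largest value
  of \<open>f\<close>.
\<close>

definition boundary_matrix :: "('a, 'k::field) cell_complex \<Rightarrow> 'a \<Rightarrow> 'a \<Rightarrow> 'k" where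
  "boundary_matrix X x y = incid X y x"

definition is_pivot ::
  "('a, 'k::field) cell_complex \<Rightarrow> ('a \<Rightarrow> real) \<Rightarrow> ('a \<Rightarrow> 'a \<Rightarrow> 'k) \<Rightarrow> 'a \<Rightarrow> 'a \<Rightarrow> bool" where
  "is_pivot X f R s t \<longleftrightarrow>
     s \<in> cells X \<and> t \<in> cells X \<and> R s t \<noteq> 0 \<and>
     (\<forall>x\<in>cells X. R x t \<noteq> 0 \<longrightarrow> f x \<le> f s)"

definition reduced_form ::
  "('a, 'k::field) cell_complex \<Rightarrow> ('a \<Rightarrow> real) \<Rightarrow> ('a \<Rightarrow> 'a \<Rightarrow> 'k) \<Rightarrow> bool" where
  "reduced_form X f R \<longleftrightarrow>
     (\<exists>V. (\<forall>x\<in>cells X. \<forall>y\<in>cells X.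
              V x y - (if x = y then 1 else 0) \<noteq> 0 \<longrightarrow> f x < f y) \<and>
          (\<forall>x\<in>cells X. \<forall>y\<in>cells X.
              R x y = (\<Sum>z\<in>cells X. boundary_matrix X x z * V z y))) \<and>
     (\<forall>s t t'. is_pivot X f R s t \<and> is_pivot X f R s t' \<longrightarrow> t = t')"

text \<open>
  All reduced forms of the boundary matrix have the same pivot positions, so quantifying
  existentially over \<open>R\<close> amounts to fixing any one reduced form.
\<close>

definition BD :: "('a, 'k::field) cell_complex \<Rightarrow> ('a \<Rightarrow> real) \<Rightarrow> ('a \<times> 'a) set" where
  "BD X f = {(s, t). \<exists>R. reduced_form X f R \<and> is_pivot X f R s t}"

definition SH :: "('a, 'k::field) cell_complex \<Rightarrow> ('a \<Rightarrow> real) \<Rightarrow> ('a \<times> 'a) set" where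
  "SH X f = {(s, t). facet X s t \<and>
     (\<forall>x. facet X x t \<longrightarrow> f x \<le> f s) \<and> (\<forall>y. facet X s y \<longrightarrow> f t \<le> f y)}"

definition cancel :: "('a, 'k::field) cell_complex \<Rightarrow> 'a \<times> 'a \<Rightarrow> ('a, 'k) cell_complex" where
  "cancel X = (\<lambda>(s, t).
     \<lparr> cells = cells X - {s, t},
       cdim = cdim X,
       incid = (\<lambda>y x. incid X y x - inverse (incid X t s) * incid X y s * incid X t x) \<rparr>)"


text \<open>
  A shallow order is a list, indexed from 0: the quotient \<open>X\<^sub>i\<close> is
  \<open>foldl cancel X (take i \<Phi>)\<close>, and the pair cancelled next is \<open>\<Phi> ! i\<close>.
\<close>

definition shallow_order ::
  "('a, 'k::field) cell_complex \<Rightarrow> ('a \<Rightarrow> real) \<Rightarrow> ('a \<times> 'a) list \<Rightarrow> bool" where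
  "shallow_order X f \<Phi> \<longleftrightarrow>
     distinct \<Phi> \<and> set \<Phi> = BD X f \<and>
     (\<forall>i<length \<Phi>. \<Phi> ! i \<in> SH (foldl cancel X (take i \<Phi>)) f)"

definition list_order :: "'b list \<Rightarrow> ('b \<times> 'b) set" where
  "list_order \<Phi> = {(\<Phi> ! i, \<Phi> ! j) | i j. i \<le> j \<and> j < length \<Phi>}"

definition depth_order ::
  "('a, 'k::field) cell_complex \<Rightarrow> ('a \<Rightarrow> real) \<Rightarrow> (('a \<times> 'a) \<times> ('a \<times> 'a)) set" where
  "depth_order X f =
     {(\<chi>, \<xi>) \<in> BD X f \<times> BD X f. \<forall>\<Phi>. shallow_order X f \<Phi> \<longrightarrow> (\<chi>, \<xi>) \<in> list_order \<Phi>}"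

definition minimal_elements :: "'b set \<Rightarrow> ('b \<times> 'b) set \<Rightarrow> 'b set" where
  "minimal_elements A r = {x \<in> A. \<forall>y\<in>A. (y, x) \<in> r \<longrightarrow> y = x}"

end

theory Submission
  imports Defs
begin

text \<open>
  Why the theorem holds. Cancelling a shallow pair \<open>\<phi>\<close> removes exactly \<open>\<phi>\<close> from the set of
  birth-death pairs and leaves the other pairs alone (\<open>BD_cancel\<close>). Since a non-zero boundary
  map always has a shallow pair, namely a facet relation with the smallest gap between filter
  values, shallow pairs can be cancelled until all birth-death pairs are used up. Hence shallow
  orders exist, and any shallow pair can be chosen as the first one. A pair that comes first in
  some shallow order has nothing below it in the depth poset.

  Conversely, let \<open>(s, t)\<close> be a birth-death pair that is not shallow. The pair becomes shallow
  only once \<open>s\<close> is the largest facet of \<open>t\<close> and \<open>t\<close> is the smallest cofacet of \<open>s\<close>, so one of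
  two obstructions is present at the start: the largest facet \<open>x\<close> of \<open>t\<close> is not \<open>s\<close>, or the
  smallest cofacet \<open>y\<close> of \<open>s\<close> is not \<open>t\<close>. (A largest facet exists: a cell without facets
  acquires none by cancellations, so it could never be the upper cell of a shallow pair.) The
  decisive observation is that the cancellation of
  a shallow pair not containing \<open>x\<close> leaves \<open>x\<close> the largest facet of \<open>t\<close>, and dually for \<open>y\<close>
  (\<open>top_facet_persists\<close>, \<open>bottom_cofacet_persists\<close>). So in every shallow order the pair
  containing the obstructing cell comes before \<open>(s, t)\<close>. As birth-death pairs are disjoint,
  it is the same pair in every shallow order, and it lies strictly below \<open>(s, t)\<close> in the depth
  poset.

  To prove \<open>BD_cancel\<close>, birth-death pairs are first described without reference to reduced
  forms: \<open>(p, u)\<close> is such a pair iff \<open>p\<close> is the leading cell of the boundary of some chain on the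
  cells up to \<open>u\<close>, but of no chain on the cells strictly before \<open>u\<close>
  (\<open>BD_iff_leads_boundary\<close>). For a shallow pair \<open>(s, t)\<close> the chain complex splits, compatibly
  with the filtration, into the complex spanned by \<open>t\<close> and its boundary, whose leading cell is
  \<open>s\<close>, and a copy of the chain complex of the quotient. Thus the leading cells of boundaries
  of chains on a lower set \<open>P\<close> are those for the quotient, together with \<open>s\<close> if \<open>t \<in> P\<close>
  (\<open>leads_boundary_cancel\<close>).
\<close>

section \<open>Boundaries of chains and their leading cells\<close>

definition chain_boundary :: "('a, 'k::field) cell_complex \<Rightarrow> ('a \<Rightarrow> 'k) \<Rightarrow> 'a \<Rightarrow> 'k" where
  "chain_boundary X v x = (\<Sum>z\<in>cells X. incid X z x * v z)"

definition leading_cell ::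
  "('a, 'k::field) cell_complex \<Rightarrow> ('a \<Rightarrow> real) \<Rightarrow> ('a \<Rightarrow> 'k) \<Rightarrow> 'a \<Rightarrow> bool" where
  "leading_cell X f c p \<longleftrightarrow>
     p \<in> cells X \<and> c p \<noteq> 0 \<and> (\<forall>x\<in>cells X. c x \<noteq> 0 \<longrightarrow> f x \<le> f p)"

definition lower_set :: "('a \<Rightarrow> real) \<Rightarrow> 'a set \<Rightarrow> bool" where
  "lower_set f P \<longleftrightarrow> (\<forall>x y. y \<in> P \<longrightarrow> f x \<le> f y \<longrightarrow> x \<in> P)"

lemma lower_setD: "\<lbrakk>lower_set f P; y \<in> P; f x \<le> f y\<rbrakk> \<Longrightarrow> x \<in> P"
  unfolding lower_set_def by blast

definition leads_boundary ::
  "('a, 'k::field) cell_complex \<Rightarrow> ('a \<Rightarrow> real) \<Rightarrow> 'a set \<Rightarrow> 'a \<Rightarrow> bool" where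
  "leads_boundary X f P p \<longleftrightarrow>
     (\<exists>v. (\<forall>z\<in>cells X. v z \<noteq> 0 \<longrightarrow> z \<in> P) \<and> leading_cell X f (chain_boundary X v) p)"

lemma chain_boundary_diff_smult:
  "chain_boundary X (\<lambda>z. v z - a * w z) x = chain_boundary X v x - a * chain_boundary X w x"
  by (simp add: chain_boundary_def sum_subtractf sum_distrib_left algebra_simps)

lemma lefschetz_finite: "lefschetz_complex X \<Longrightarrow> finite (cells X)"
  by (simp add: lefschetz_complex_def)

lemma lefschetz_square:
  "\<lbrakk>lefschetz_complex X; z \<in> cells X; x \<in> cells X\<rbrakk>
    \<Longrightarrow> (\<Sum>y\<in>cells X. incid X z y * incid X y x) = 0"
  by (simp add: lefschetz_complex_def)

lemma filter_inj:
  "\<lbrakk>filter_on X f; x \<in> cells X; y \<in> cells X; f x = f y\<rbrakk> \<Longrightarrow> x = y"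
  by (auto simp: filter_on_def inj_on_def)

lemma filter_less: "\<lbrakk>filter_on X f; facet X x y\<rbrakk> \<Longrightarrow> f x < f y"
  by (auto simp: filter_on_def)

lemma ex_leading_cell:
  assumes "finite (cells X)" "x \<in> cells X" "c x \<noteq> 0"
  shows "\<exists>p. leading_cell X f c p"
proof -
  let ?S = "{y \<in> cells X. c y \<noteq> 0}"
  have "finite ?S" "?S \<noteq> {}" using assms by auto
  then have "Max (f ` ?S) \<in> f ` ?S" by simp
  then obtain p where p: "Max (f ` ?S) = f p" "p \<in> ?S" by (rule imageE)
  have "f y \<le> f p" if "y \<in> ?S" for y
    unfolding p(1)[symmetric] using \<open>finite ?S\<close> that by (blast intro: Max_ge)
  with p(2) show ?thesis unfolding leading_cell_def by blast
qed

lemma leading_cell_unique: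
  "\<lbrakk>filter_on X f; leading_cell X f c p; leading_cell X f c q\<rbrakk> \<Longrightarrow> p = q"
  unfolding leading_cell_def by (meson antisym filter_inj)

section \<open>Birth-death pairs without reduced forms\<close>

lemma is_pivot_iff_leading_cell:
  "is_pivot X f R s t \<longleftrightarrow> t \<in> cells X \<and> leading_cell X f (\<lambda>x. R x t) s"
  by (auto simp: is_pivot_def leading_cell_def)

lemma reduced_formE:
  assumes "reduced_form X f R"
  obtains V where
    "\<And>y. y \<in> cells X \<Longrightarrow> V y y = 1"
    "\<And>x y. \<lbrakk>x \<in> cells X; y \<in> cells X; V x y \<noteq> 0; x \<noteq> y\<rbrakk> \<Longrightarrow> f x < f y"
    "\<And>x y. \<lbrakk>x \<in> cells X; y \<in> cells X\<rbrakk> \<Longrightarrow> R x y = chain_boundary X (\<lambda>z. V z y) x"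
    "\<And>s t t'. \<lbrakk>is_pivot X f R s t; is_pivot X f R s t'\<rbrakk> \<Longrightarrow> t = t'"
proof -
  from assms obtain V where
    V: "\<And>x y. \<lbrakk>x \<in> cells X; y \<in> cells X; V x y - (if x = y then 1 else 0) \<noteq> 0\<rbrakk> \<Longrightarrow> f x < f y"
    and R: "\<And>x y. \<lbrakk>x \<in> cells X; y \<in> cells X\<rbrakk>
        \<Longrightarrow> R x y = (\<Sum>z\<in>cells X. boundary_matrix X x z * V z y)"
    and U: "\<And>s t t'. \<lbrakk>is_pivot X f R s t; is_pivot X f R s t'\<rbrakk> \<Longrightarrow> t = t'"
    unfolding reduced_form_def by blast
  show thesis
  proof (rule that[of V])
    show "V y y = 1" if "y \<in> cells X" for y using V[OF that that] by auto
    show "f x < f y" if "x \<in> cells X" "y \<in> cells X" "V x y \<noteq> 0" "x \<noteq> y" for x y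
      using V[of x y] that by auto
    show "R x y = chain_boundary X (\<lambda>z. V z y) x" if "x \<in> cells X" "y \<in> cells X" for x y
      using R[OF that] by (simp add: chain_boundary_def boundary_matrix_def)
  qed (use U in blast)
qed

text \<open>
  The columns of \<open>V\<close> with index in \<open>P\<close> form a basis of the chains on \<open>P\<close>, and the non-zero ones
  among their boundaries have different leading cells, so that the leading terms of a linear
  combination cannot annihilate each other. The basis expansion is obtained one vector at a time:
  subtracting a multiple of column \<open>u\<close>, where \<open>u\<close> is the largest cell of the chain, moves the
  chain to the cells strictly before \<open>u\<close>.
\<close>
lemma leads_boundary_iff_pivot:
  assumes fin: "finite (cells X)" and filt: "filter_on X f" and red: "reduced_form X f R"
    and "lower_set f P"
  shows "leads_boundary X f P p \<longleftrightarrow> (\<exists>z\<in>P. is_pivot X f R p z)"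
proof -
  obtain V where diag: "\<And>y. y \<in> cells X \<Longrightarrow> V y y = 1"
    and upper: "\<And>x y. \<lbrakk>x \<in> cells X; y \<in> cells X; V x y \<noteq> 0; x \<noteq> y\<rbrakk> \<Longrightarrow> f x < f y"
    and R: "\<And>x y. \<lbrakk>x \<in> cells X; y \<in> cells X\<rbrakk> \<Longrightarrow> R x y = chain_boundary X (\<lambda>z. V z y) x"
    and inj: "\<And>s t t'. \<lbrakk>is_pivot X f R s t; is_pivot X f R s t'\<rbrakk> \<Longrightarrow> t = t'"
    using reduced_formE[OF red] by blast
  show ?thesis
  proof
    assume "\<exists>z\<in>P. is_pivot X f R p z"
    then obtain z where z: "z \<in> P" "z \<in> cells X" "leading_cell X f (\<lambda>x. R x z) p"
      by (auto simp: is_pivot_iff_leading_cell)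
    have "leading_cell X f (chain_boundary X (\<lambda>x. V x z)) p"
      using z(3) R[OF _ z(2)] by (auto simp: leading_cell_def)
    moreover have "x \<in> P" if "x \<in> cells X" "V x z \<noteq> 0" for x
      using upper[OF that(1) z(2) that(2)] z(1) lower_setD[OF \<open>lower_set f P\<close> z(1), of x]
      by (cases "x = z") auto
    ultimately show "leads_boundary X f P p" unfolding leads_boundary_def
      by (intro exI[of _ "\<lambda>x. V x z"]) simp
  next
    assume "leads_boundary X f P p"
    then obtain v where "\<And>z. \<lbrakk>z \<in> cells X; v z \<noteq> 0\<rbrakk> \<Longrightarrow> z \<in> P"
      "leading_cell X f (chain_boundary X v) p"
      unfolding leads_boundary_def by blast
    with \<open>lower_set f P\<close> show "\<exists>z\<in>P. is_pivot X f R p z"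
    proof (induction "card (cells X \<inter> P)" arbitrary: P v p rule: less_induct)
      case less
      let ?S = "{z \<in> cells X. v z \<noteq> 0}"
      have "?S \<noteq> {}"
      proof
        assume "?S = {}"
        then have "chain_boundary X v p = 0" unfolding chain_boundary_def
          by (intro sum.neutral) auto
        with less.prems(3) show False by (simp add: leading_cell_def)
      qed
      then obtain u where u: "leading_cell X f v u"
        using ex_leading_cell[OF fin] by blast
      then have uX: "u \<in> cells X" and uP: "u \<in> P"
        using less.prems(2) by (auto simp: leading_cell_def)
      let ?Q = "{z. f z < f u}"
      have QsubP: "?Q \<subseteq> P"
        by (auto intro!: lower_setD[OF less.prems(1) uP])
      have card: "card (cells X \<inter> ?Q) < card (cells X \<inter> P)"
      proof (rule psubset_card_mono)
        show "cells X \<inter> ?Q \<subset> cells X \<inter> P" using uX uP QsubP by auto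
      qed (simp add: fin)
      have low: "lower_set f ?Q" by (auto simp: lower_set_def)
      define w where "w = (\<lambda>z. v z - v u * V z u)"
      have wQ: "z \<in> ?Q" if z: "z \<in> cells X" "w z \<noteq> 0" for z
      proof -
        have "z \<noteq> u" using z(2) diag[OF uX] by (auto simp: w_def)
        moreover have "v z \<noteq> 0 \<or> V z u \<noteq> 0" using z(2) by (auto simp: w_def)
        ultimately show ?thesis
          using u z(1) upper[OF z(1) uX] filter_inj[OF filt z(1) uX]
          by (force simp: leading_cell_def less_le)
      qed
      have bw: "chain_boundary X w x = chain_boundary X v x - v u * R x u" if "x \<in> cells X" for x
        unfolding w_def by (simp add: chain_boundary_diff_smult R[OF that uX])
      have QP: "\<exists>z\<in>P. is_pivot X f R p z" if "\<exists>z\<in>?Q. is_pivot X f R p z"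
        using that QsubP by auto
      have vu: "v u \<noteq> 0" using u by (simp add: leading_cell_def)
      show ?case
      proof (cases "\<exists>x\<in>cells X. R x u \<noteq> 0")
        case False
        then have "leading_cell X f (chain_boundary X w) p"
          using less.prems(3) bw by (auto simp: leading_cell_def)
        then show ?thesis using less.hyps[OF card low wQ] QP by blast
      next
        case True
        then obtain q where q: "leading_cell X f (\<lambda>x. R x u) q"
          using ex_leading_cell[OF fin, where c = "\<lambda>x. R x u" and f = f] by blast
        then have piv: "is_pivot X f R q u" using uX by (simp add: is_pivot_iff_leading_cell)
        consider "p = q" | "p \<noteq> q" "f q < f p" | "p \<noteq> q" "f p < f q"
          using filter_inj[OF filt, of p q] q less.prems(3)
          by (force simp: leading_cell_def)
        then show ?thesis
        proof cases
          case 1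
          then show ?thesis using piv uP by blast
        next
          case 2
          have "leading_cell X f (chain_boundary X w) p"
            unfolding leading_cell_def
          proof (intro conjI ballI impI)
            show "p \<in> cells X" using less.prems(3) by (simp add: leading_cell_def)
            have "R p u = 0" using 2 q less.prems(3) by (force simp: leading_cell_def)
            then show "chain_boundary X w p \<noteq> 0"
              using bw less.prems(3) by (simp add: leading_cell_def)
            fix x assume x: "x \<in> cells X" "chain_boundary X w x \<noteq> 0"
            then have "chain_boundary X v x \<noteq> 0 \<or> R x u \<noteq> 0" using bw by auto
            then show "f x \<le> f p" using x 2 q less.prems(3) by (force simp: leading_cell_def)
          qed
          then show ?thesis using less.hyps[OF card low wQ] QP by blast
        next
          case 3
          have "leading_cell X f (chain_boundary X w) q"
            unfolding leading_cell_def
          proof (intro conjI ballI impI)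
            show qX: "q \<in> cells X" using q by (simp add: leading_cell_def)
            have "chain_boundary X v q = 0"
              using 3 qX less.prems(3) by (force simp: leading_cell_def)
            then show "chain_boundary X w q \<noteq> 0"
              using bw q vu by (simp add: leading_cell_def)
            fix x assume x: "x \<in> cells X" "chain_boundary X w x \<noteq> 0"
            then have "chain_boundary X v x \<noteq> 0 \<or> R x u \<noteq> 0" using bw by auto
            then show "f x \<le> f q" using x 3 q less.prems(3) by (force simp: leading_cell_def)
          qed
          \<comment> \<open>Now \<open>q\<close> would be the pivot of column \<open>u\<close> and of an earlier one.\<close>
          then obtain z where "f z < f u" "is_pivot X f R q z"
            using less.hyps[OF card low wQ] by blast
          then show ?thesis using inj[OF piv] by blast
        qed
      qed
    qed
  qed
qed

text \<open>
  Instead of running the column reduction, choose for every \<open>t\<close> a column whose boundary has the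
  lowest possible leading cell. If two columns had the same pivot, subtracting a multiple of the
  earlier one would push the later one further down.
\<close>
lemma ex_reduced_form:
  assumes fin: "finite (cells X)" and filt: "filter_on X f"
  shows "\<exists>R. reduced_form X f R"
proof -
  define adm where
    "adm t v \<longleftrightarrow> v t = 1 \<and> (\<forall>x\<in>cells X. v x \<noteq> 0 \<longrightarrow> x \<noteq> t \<longrightarrow> f x < f t)" for t and v :: "'a \<Rightarrow> 'b"
  \<comment> \<open>The position of the leading cell, counted from 1; a vanishing boundary has height 0.\<close>
  define height where
    "height v = card {x \<in> cells X. \<exists>y\<in>cells X. chain_boundary X v y \<noteq> 0 \<and> f x \<le> f y}"
    for v :: "'a \<Rightarrow> 'b"
  have "\<exists>v. adm t v \<and> (\<forall>w. adm t w \<longrightarrow> height v \<le> height w)" for t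
    by (rule ex_has_least_nat[of "adm t" "\<lambda>x. if x = t then 1 else 0"]) (simp add: adm_def)
  then obtain C where C: "\<And>t. adm t (C t)" "\<And>t w. adm t w \<Longrightarrow> height (C t) \<le> height w"
    by metis
  define R where "R x t = chain_boundary X (C t) x" for x t
  have inj: False if tt: "is_pivot X f R s t" "is_pivot X f R s t'" "f t < f t'" for s t t'
  proof -
    let ?a = "R s t' / R s t"
    define w where "w = (\<lambda>z. C t' z - ?a * C t z)"
    have t: "t \<in> cells X" "t' \<in> cells X" and s: "s \<in> cells X"
      using tt by (auto simp: is_pivot_def)
    have "adm t' w" unfolding adm_def
    proof (intro conjI ballI impI)
      have "C t t' = 0" using C(1)[of t] t tt(3) by (fastforce simp: adm_def)
      then show "w t' = 1" using C(1)[of t'] by (simp add: w_def adm_def)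
      fix x assume x: "x \<in> cells X" "w x \<noteq> 0" "x \<noteq> t'"
      then have "C t' x \<noteq> 0 \<or> C t x \<noteq> 0" by (auto simp: w_def)
      then show "f x < f t'" using C(1)[of t] C(1)[of t'] x tt(3) by (fastforce simp: adm_def)
    qed
    moreover have "height w < height (C t')" unfolding height_def
    proof (rule psubset_card_mono)
      let ?A = "{x \<in> cells X. \<exists>y\<in>cells X. chain_boundary X w y \<noteq> 0 \<and> f x \<le> f y}"
      let ?B = "{x \<in> cells X. \<exists>y\<in>cells X. chain_boundary X (C t') y \<noteq> 0 \<and> f x \<le> f y}"
      have bw: "chain_boundary X w y = R y t' - ?a * R y t" for y
        unfolding w_def R_def by (rule chain_boundary_diff_smult)
      have below: "f y < f s" if y: "y \<in> cells X" "chain_boundary X w y \<noteq> 0" for y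
      proof -
        have "y \<noteq> s" using y(2) tt(1) by (auto simp: bw is_pivot_def)
        moreover have "R y t' \<noteq> 0 \<or> R y t \<noteq> 0" using y(2) by (auto simp: bw)
        then have "f y \<le> f s" using tt y(1) by (auto simp: is_pivot_def)
        ultimately show ?thesis using filter_inj[OF filt y(1) s] by fastforce
      qed
      have sB: "chain_boundary X (C t') s \<noteq> 0" using tt(2) by (simp add: is_pivot_def R_def)
      have "?A \<subseteq> ?B" using below s sB by (fastforce)
      moreover have "s \<in> ?B" "s \<notin> ?A" using s sB below by (auto simp: not_le)
      ultimately show "?A \<subset> ?B" by blast
    qed (simp add: fin)
    ultimately show False using C(2)[of t' w] by simp
  qed
  have "reduced_form X f R" unfolding reduced_form_def
  proof (intro conjI exI[of _ "\<lambda>x t. C t x"] ballI allI impI)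
    fix x y assume "x \<in> cells X" "y \<in> cells X" "C y x - (if x = y then 1 else 0) \<noteq> 0"
    then show "f x < f y" using C(1)[of y] by (auto simp: adm_def split: if_splits)
  next
    fix x y show "R x y = (\<Sum>z\<in>cells X. boundary_matrix X x z * C y z)"
      by (simp add: R_def chain_boundary_def boundary_matrix_def)
  next
    fix s t t' assume *: "is_pivot X f R s t \<and> is_pivot X f R s t'"
    then have "t \<in> cells X" "t' \<in> cells X" by (auto simp: is_pivot_def)
    then show "t = t'"
      using inj[of s t t'] inj[of s t' t] * filter_inj[OF filt, of t t'] by force
  qed
  then show ?thesis by blast
qed

text \<open>
  In particular the birth-death pairs do not depend on the reduced form. This is the description
  that behaves well under cancellation, because it makes no choice of columns.
\<close>
lemma BD_iff_leads_boundary: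
  assumes fin: "finite (cells X)" and filt: "filter_on X f"
  shows "(p, u) \<in> BD X f \<longleftrightarrow> u \<in> cells X \<and>
    leads_boundary X f {z. f z \<le> f u} p \<and> \<not> leads_boundary X f {z. f z < f u} p"
proof -
  have low: "lower_set f {z. f z \<le> f u}" "lower_set f {z. f z < f u}"
    by (auto simp: lower_set_def)
  have key: "is_pivot X f R p u \<longleftrightarrow> u \<in> cells X \<and>
    leads_boundary X f {z. f z \<le> f u} p \<and> \<not> leads_boundary X f {z. f z < f u} p"
    if red: "reduced_form X f R" for R
  proof -
    have uniq: "t = t'" if "is_pivot X f R p t" "is_pivot X f R p t'" for t t'
      using red that unfolding reduced_form_def by blast
    have inX: "z \<in> cells X" if "is_pivot X f R p z" for z using that by (simp add: is_pivot_def)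
    have "is_pivot X f R p u \<longleftrightarrow> u \<in> cells X \<and>
      (\<exists>z. f z \<le> f u \<and> is_pivot X f R p z) \<and> \<not> (\<exists>z. f z < f u \<and> is_pivot X f R p z)"
    proof
      assume "is_pivot X f R p u"
      then show "u \<in> cells X \<and>
        (\<exists>z. f z \<le> f u \<and> is_pivot X f R p z) \<and> \<not> (\<exists>z. f z < f u \<and> is_pivot X f R p z)"
        using uniq inX by blast
    next
      assume u: "u \<in> cells X \<and>
        (\<exists>z. f z \<le> f u \<and> is_pivot X f R p z) \<and> \<not> (\<exists>z. f z < f u \<and> is_pivot X f R p z)"
      then obtain z where z: "f z = f u" "is_pivot X f R p z" by (auto simp: le_less)
      then show "is_pivot X f R p u" using filter_inj[OF filt inX[OF z(2)] _ z(1)] u by blast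
    qed
    then show ?thesis
      by (simp add: leads_boundary_iff_pivot[OF fin filt red low(1)]
        leads_boundary_iff_pivot[OF fin filt red low(2)])
  qed
  show ?thesis using key ex_reduced_form[OF fin filt] unfolding BD_def by blast
qed

lemma BD_in_cells:
  assumes "(s, t) \<in> BD X f" shows "s \<in> cells X" "t \<in> cells X"
  using assms by (auto simp: BD_def is_pivot_def)

section \<open>Cancelling a shallow pair\<close>

locale shallow_cancellation =
  fixes X :: "('a, 'k::field) cell_complex" and f :: "'a \<Rightarrow> real" and s t :: 'a
  assumes lef: "lefschetz_complex X" and filt: "filter_on X f" and shallow: "(s, t) \<in> SH X f"
begin

abbreviation Q where "Q \<equiv> cancel X (s, t)"

lemma cells_Q: "cells Q = cells X - {s, t}"
  and incid_Q: "incid Q y x = incid X y x - inverse (incid X t s) * incid X y s * incid X t x"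
  and cdim_Q: "cdim Q = cdim X"
  by (simp_all add: cancel_def)

lemma fin: "finite (cells X)" using lef by (rule lefschetz_finite)

lemma s_in: "s \<in> cells X" and t_in: "t \<in> cells X" and ts: "incid X t s \<noteq> 0"
  using shallow by (auto simp: SH_def facet_def)

lemma facet_t_le: "\<lbrakk>x \<in> cells X; incid X t x \<noteq> 0\<rbrakk> \<Longrightarrow> f x \<le> f s"
  using shallow t_in by (auto simp: SH_def facet_def)

lemma cofacet_s_ge: "\<lbrakk>y \<in> cells X; incid X y s \<noteq> 0\<rbrakk> \<Longrightarrow> f t \<le> f y"
  using shallow s_in by (auto simp: SH_def facet_def)

lemma s_less_t: "f s < f t"
  using filter_less[OF filt] shallow by (auto simp: SH_def)

lemma incid_less: "\<lbrakk>x \<in> cells X; y \<in> cells X; incid X y x \<noteq> 0\<rbrakk> \<Longrightarrow> f x < f y"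
  using filter_less[OF filt] by (simp add: facet_def)

lemma lefschetz_Q: "lefschetz_complex Q"
  unfolding lefschetz_complex_def
proof (intro conjI ballI impI)
  show "finite (cells Q)" using fin by (simp add: cells_Q)
next
  fix z x assume "z \<in> cells Q" "x \<in> cells Q"
  then have z: "z \<in> cells X" and x: "x \<in> cells X" by (auto simp: cells_Q)
  let ?c = "inverse (incid X t s)"
  let ?S = "\<lambda>z x. \<Sum>y\<in>cells X. incid X z y * incid X y x"
  \<comment> \<open>The two extra summands vanish: the incidence formula of the quotient gives 0 in column
    \<open>s\<close> and in row \<open>t\<close>.\<close>
  have "(\<Sum>y\<in>cells Q. incid Q z y * incid Q y x) = (\<Sum>y\<in>cells X. incid Q z y * incid Q y x)"
  proof (rule sum.mono_neutral_left)
    show "\<forall>y\<in>cells X - cells Q. incid Q z y * incid Q y x = 0"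
      using ts by (auto simp: cells_Q incid_Q)
  qed (auto simp: fin cells_Q)
  also have "\<dots> = ?S z x - ?c * incid X t x * ?S z s - ?c * incid X z s * ?S t x
      + ?c * ?c * incid X z s * incid X t x * ?S t s"
    unfolding incid_Q sum_distrib_left sum_subtractf[symmetric] sum.distrib[symmetric]
    by (rule sum.cong) (auto simp: algebra_simps)
  also have "\<dots> = 0" using lefschetz_square[OF lef] z x s_in t_in by simp
  finally show "(\<Sum>y\<in>cells Q. incid Q z y * incid Q y x) = 0" .
next
  fix y x assume "y \<in> cells Q" "x \<in> cells Q" and nz: "incid Q y x \<noteq> 0"
  then have y: "y \<in> cells X" and x: "x \<in> cells X" by (auto simp: cells_Q)
  have dim: "cdim X b = cdim X a + 1" if "a \<in> cells X" "b \<in> cells X" "incid X b a \<noteq> 0" for a b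
    using lef that by (simp add: lefschetz_complex_def)
  have "incid X y x \<noteq> 0 \<or> incid X y s \<noteq> 0 \<and> incid X t x \<noteq> 0" using nz by (auto simp: incid_Q)
  then show "cdim Q y = cdim Q x + 1"
    using dim[OF x y] dim[OF s_in y] dim[OF x t_in] dim[OF s_in t_in ts] by (auto simp: cdim_Q)
qed

lemma filter_Q: "filter_on Q f"
  unfolding filter_on_def
proof (intro conjI allI impI)
  show "inj_on f (cells Q)"
    using filt unfolding filter_on_def cells_Q by (blast intro: inj_on_subset)
  fix x y assume "facet Q x y"
  then have y: "y \<in> cells X" and x: "x \<in> cells X" and nz: "incid Q y x \<noteq> 0"
    by (auto simp: facet_def cells_Q)
  have "incid X y x \<noteq> 0 \<or> incid X y s \<noteq> 0 \<and> incid X t x \<noteq> 0" using nz by (auto simp: incid_Q)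
  then show "f x < f y"
    using incid_less[OF x y] facet_t_le[OF x] cofacet_s_ge[OF y] s_less_t by auto
qed

text \<open>The coefficient of \<open>s\<close> in the boundary of a boundary.\<close>
lemma boundary_s_zero:
  "(\<Sum>x\<in>cells X. incid X x s * chain_boundary X v x) = 0"
proof -
  have "(\<Sum>x\<in>cells X. incid X x s * chain_boundary X v x) =
      (\<Sum>x\<in>cells X. \<Sum>z\<in>cells X. v z * (incid X z x * incid X x s))"
    unfolding chain_boundary_def sum_distrib_left by (intro sum.cong) (auto simp: algebra_simps)
  also have "\<dots> = (\<Sum>z\<in>cells X. v z * (\<Sum>x\<in>cells X. incid X z x * incid X x s))"
    unfolding sum_distrib_left by (rule sum.swap)
  also have "\<dots> = 0" using lefschetz_square[OF lef _ s_in] by simp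
  finally show ?thesis .
qed

text \<open>
  The cell \<open>t\<close> is never the leading cell of a boundary: taking the boundary once more, the
  contribution of \<open>t\<close> to the coefficient of \<open>s\<close> has to be compensated by another cofacet of \<open>s\<close>,
  and all of these lie above \<open>t\<close>.
\<close>
lemma boundary_above_t:
  assumes "chain_boundary X v t \<noteq> 0"
  shows "\<exists>x\<in>cells Q. chain_boundary X v x \<noteq> 0 \<and> f t < f x"
proof -
  have "(\<Sum>x\<in>cells X - {t}. incid X x s * chain_boundary X v x) \<noteq> 0"
    using boundary_s_zero[of v] assms ts sum.remove[OF fin t_in, of "\<lambda>x. incid X x s * chain_boundary X v x"]
    by auto
  then obtain x where x: "x \<in> cells X - {t}" "incid X x s * chain_boundary X v x \<noteq> 0"
    by (blast elim: sum.not_neutral_contains_not_neutral)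
  then have nz: "incid X x s \<noteq> 0" "chain_boundary X v x \<noteq> 0" by auto
  have "f t \<le> f x" using cofacet_s_ge nz x by auto
  then have "f t < f x" using x filter_inj[OF filt t_in, of x] by force
  moreover have "x \<noteq> s" using s_less_t \<open>f t < f x\<close> by auto
  ultimately show ?thesis using x nz by (auto simp: cells_Q)
qed

lemma chain_boundary_Q:
  assumes "v s = 0" "x \<in> cells X"
  shows "chain_boundary X v x =
    chain_boundary Q v x + inverse (incid X t s) * chain_boundary X v s * incid X t x"
proof -
  let ?c = "inverse (incid X t s)"
  have "chain_boundary Q v x = (\<Sum>z\<in>cells X. incid Q z x * v z)"
    unfolding chain_boundary_def
  proof (rule sum.mono_neutral_left)
    show "\<forall>z\<in>cells X - cells Q. incid Q z x * v z = 0"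
      using ts assms by (auto simp: cells_Q incid_Q)
  qed (auto simp: fin cells_Q)
  also have "\<dots> = chain_boundary X v x - ?c * chain_boundary X v s * incid X t x"
    unfolding chain_boundary_def sum_distrib_left sum_distrib_right sum_subtractf[symmetric]
    by (rule sum.cong) (auto simp: incid_Q algebra_simps)
  finally show ?thesis by simp
qed

text \<open>
  Chains without \<open>s\<close> whose boundary avoids \<open>s\<close> form the copy of the chain complex of the
  quotient. The two boundaries agree on all cells; the cell \<open>t\<close>, which the quotient lacks, is
  harmless because it does not lead.
\<close>
lemma leading_cell_Q:
  assumes "v s = 0" "chain_boundary X v s = 0"
  shows "leading_cell X f (chain_boundary X v) p \<longleftrightarrow> leading_cell Q f (chain_boundary Q v) p"
proof -
  have eq: "chain_boundary X v x = chain_boundary Q v x" if "x \<in> cells X" for x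
    using chain_boundary_Q[of v x] assms that by simp
  show ?thesis
  proof
    assume L: "leading_cell X f (chain_boundary X v) p"
    then have "p \<noteq> t" using boundary_above_t[of v] by (force simp: leading_cell_def cells_Q)
    then have "p \<in> cells Q" using L assms by (auto simp: leading_cell_def cells_Q)
    then show "leading_cell Q f (chain_boundary Q v) p"
      using L eq by (auto simp: leading_cell_def cells_Q)
  next
    assume L: "leading_cell Q f (chain_boundary Q v) p"
    have "f x \<le> f p" if x: "x \<in> cells X" "chain_boundary X v x \<noteq> 0" for x
    proof (cases "x = t")
      case True
      then obtain y where "y \<in> cells Q" "chain_boundary X v y \<noteq> 0" "f t < f y"
        using boundary_above_t[of v] x by blast
      then show ?thesis using L eq[of y] True by (force simp: leading_cell_def cells_Q)
    next
      case False
      then have "x \<in> cells Q" using x assms(2) by (auto simp: cells_Q)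
      then show ?thesis using L eq[of x] x by (auto simp: leading_cell_def)
    qed
    then show "leading_cell X f (chain_boundary X v) p"
      using L eq by (auto simp: leading_cell_def cells_Q)
  qed
qed

text \<open>
  From left to right, \<open>s\<close> is first removed from the chain by subtracting a multiple of the boundary
  of \<open>t\<close>, which changes nothing in the boundary of the chain. If the coefficient of \<open>s\<close> in that
  boundary then vanishes, the chain comes from the quotient. Otherwise the chain involves a
  cofacet of \<open>s\<close>, whence \<open>t \<in> P\<close>, and a leading cell other than \<open>s\<close> lies above all facets of
  \<open>t\<close>, where the boundaries in the complex and in its quotient agree. From right to left, a chain of the quotient is
  completed by the multiple of \<open>t\<close> that removes \<open>s\<close> from its boundary.
\<close>
lemma leads_boundary_cancel:
  assumes low: "lower_set f P"
  shows "leads_boundary X f P p \<longleftrightarrow> leads_boundary Q f P p \<or> p = s \<and> t \<in> P"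
proof
  assume "leads_boundary X f P p"
  then obtain v where v: "\<And>z. \<lbrakk>z \<in> cells X; v z \<noteq> 0\<rbrakk> \<Longrightarrow> z \<in> P"
    and L: "leading_cell X f (chain_boundary X v) p"
    unfolding leads_boundary_def by blast
  define w where "w = (\<lambda>z. v z - v s * inverse (incid X t s) * incid X t z)"
  have ws: "w s = 0" using ts by (simp add: w_def)
  have wP: "z \<in> P" if z: "z \<in> cells X" "w z \<noteq> 0" for z
  proof (cases "v z = 0")
    case True
    then have "v s \<noteq> 0" "incid X t z \<noteq> 0" using z by (auto simp: w_def)
    then have "s \<in> P" "f z \<le> f s" using v s_in facet_t_le z by auto
    then show ?thesis using low by (blast intro: lower_setD)
  qed (use v z in blast)
  have "chain_boundary X w x = chain_boundary X v x" if "x \<in> cells X" for x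
  proof -
    have "chain_boundary X (incid X t) x = 0"
      using lefschetz_square[OF lef t_in that] by (simp add: chain_boundary_def mult.commute)
    then show ?thesis unfolding w_def by (simp add: chain_boundary_diff_smult)
  qed
  then have Lw: "leading_cell X f (chain_boundary X w) p"
    using L by (auto simp: leading_cell_def)
  show "leads_boundary Q f P p \<or> p = s \<and> t \<in> P"
  proof (cases "chain_boundary X w s = 0")
    case True
    then have "leading_cell Q f (chain_boundary Q w) p" using leading_cell_Q[of w p] ws Lw by simp
    then show ?thesis using wP unfolding leads_boundary_def by (auto simp: cells_Q)
  next
    case False
    then obtain y where "y \<in> cells X" "incid X y s * w y \<noteq> 0"
      unfolding chain_boundary_def by (blast elim: sum.not_neutral_contains_not_neutral)
    then have "f t \<le> f y" "y \<in> P" using cofacet_s_ge wP by auto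
    then have tP: "t \<in> P" using low by (blast intro: lower_setD)
    show ?thesis
    proof (cases "p = s")
      case False
      have pX: "p \<in> cells X" and "f s \<le> f p"
        using Lw s_in \<open>chain_boundary X w s \<noteq> 0\<close> by (auto simp: leading_cell_def)
      then have sp: "f s < f p" using False filter_inj[OF filt s_in, of p] by force
      have "p \<noteq> t" using boundary_above_t[of w] Lw by (force simp: leading_cell_def cells_Q)
      then have pQ: "p \<in> cells Q" using pX False by (simp add: cells_Q)
      have tp: "incid X t p = 0" using facet_t_le[OF pX] sp by force
      have "leading_cell Q f (chain_boundary Q w) p" unfolding leading_cell_def
      proof (intro conjI ballI impI)
        show "chain_boundary Q w p \<noteq> 0"
          using chain_boundary_Q[of w p] ws pX tp Lw by (simp add: leading_cell_def)
        fix x assume "x \<in> cells Q" and nz: "chain_boundary Q w x \<noteq> 0"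
        then have x: "x \<in> cells X" by (simp add: cells_Q)
        have "chain_boundary X w x \<noteq> 0 \<or> incid X t x \<noteq> 0"
          using chain_boundary_Q[of w x] ws x nz by auto
        then show "f x \<le> f p" using Lw x facet_t_le[OF x] sp by (auto simp: leading_cell_def)
      qed (rule pQ)
      then show ?thesis using wP unfolding leads_boundary_def by (auto simp: cells_Q)
    qed (simp add: tP)
  qed
next
  assume "leads_boundary Q f P p \<or> p = s \<and> t \<in> P"
  then show "leads_boundary X f P p"
  proof
    assume "leads_boundary Q f P p"
    then obtain v where v: "\<And>z. \<lbrakk>z \<in> cells Q; v z \<noteq> 0\<rbrakk> \<Longrightarrow> z \<in> P"
      and L: "leading_cell Q f (chain_boundary Q v) p"
      unfolding leads_boundary_def by blast
    define a where "a = inverse (incid X t s) * (\<Sum>z\<in>cells Q. incid X z s * v z)"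
    define w where "w = v(s := 0, t := - a)"
    have st: "s \<noteq> t" using s_less_t by auto
    have "chain_boundary X w s = incid X t s * w t + (incid X s s * w s + (\<Sum>z\<in>cells Q. incid X z s * w z))"
    proof -
      have "cells Q = cells X - {t} - {s}" by (auto simp: cells_Q)
      then show ?thesis unfolding chain_boundary_def
        using fin t_in s_in st by (simp add: sum.remove[of _ t] sum.remove[of _ s])
    qed
    also have "(\<Sum>z\<in>cells Q. incid X z s * w z) = (\<Sum>z\<in>cells Q. incid X z s * v z)"
      by (rule sum.cong) (auto simp: w_def cells_Q)
    also have "incid X t s * w t + (incid X s s * w s + (\<Sum>z\<in>cells Q. incid X z s * v z)) = 0"
      using ts st by (simp add: w_def a_def)
    finally have ws0: "chain_boundary X w s = 0" .
    have "chain_boundary Q w = chain_boundary Q v"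
      unfolding chain_boundary_def w_def by (intro ext sum.cong) (auto simp: cells_Q)
    then have Lw: "leading_cell X f (chain_boundary X w) p"
      using leading_cell_Q[of w p] ws0 L st by (simp add: w_def)
    have "z \<in> P" if z: "z \<in> cells X" "w z \<noteq> 0" for z
    proof (cases "z = t")
      case True
      then have "(\<Sum>z\<in>cells Q. incid X z s * v z) \<noteq> 0" using z by (auto simp: w_def a_def)
      then obtain y where "y \<in> cells Q" "incid X y s * v y \<noteq> 0" by (blast elim: sum.not_neutral_contains_not_neutral)
      then have "f t \<le> f y" "y \<in> P" using cofacet_s_ge v by (auto simp: cells_Q)
      then show ?thesis using low True by (blast intro: lower_setD)
    next
      case False
      then show ?thesis using z v[of z] by (auto simp: w_def cells_Q split: if_splits)
    qed
    then show ?thesis using Lw unfolding leads_boundary_def by blast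
  next
    assume ps: "p = s \<and> t \<in> P"
    let ?e = "\<lambda>z. if z = t then 1 else (0::'k)"
    have "chain_boundary X ?e x = incid X t x" for x
      unfolding chain_boundary_def using fin t_in by (simp add: if_distrib cong: if_cong)
    then have "leading_cell X f (chain_boundary X ?e) s"
      using s_in ts facet_t_le by (simp add: leading_cell_def)
    then show ?thesis unfolding leads_boundary_def using ps by (intro exI[of _ ?e]) auto
  qed
qed

text \<open>
  The leading cell \<open>s\<close> appears exactly when \<open>t\<close> enters the lower set, and entering \<open>s\<close> or \<open>t\<close>
  changes nothing for the quotient, which does not contain them.
\<close>
lemma BD_cancel: "BD X f = insert (s, t) (BD Q f)"
proof -
  have finQ: "finite (cells Q)" using fin by (simp add: cells_Q)
  have low: "lower_set f {z. f z \<le> f u}" "lower_set f {z. f z < f u}" for u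
    by (auto simp: lower_set_def)
  have notQ: "\<not> leads_boundary Q f P s" for P
    by (simp add: leads_boundary_def leading_cell_def cells_Q)
  have same: "leads_boundary Q f {z. f z \<le> f u} p \<longleftrightarrow> leads_boundary Q f {z. f z < f u} p"
    if "u = s \<or> u = t" for u p
  proof -
    have "f z \<noteq> f u" if "z \<in> cells Q" for z
      using that \<open>u = s \<or> u = t\<close> filter_inj[OF filt, of z u] s_in t_in by (auto simp: cells_Q)
    then show ?thesis unfolding leads_boundary_def by (simp add: less_le cong: conj_cong)
  qed
  have "(p, u) \<in> BD X f \<longleftrightarrow> (p, u) = (s, t) \<or> (p, u) \<in> BD Q f" for p u
  proof (cases "u \<in> cells Q")
    case True
    then have "u \<in> cells X" "u \<noteq> t" "f t \<noteq> f u"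
      using filter_inj[OF filt t_in, of u] by (auto simp: cells_Q)
    then show ?thesis
      unfolding BD_iff_leads_boundary[OF fin filt] BD_iff_leads_boundary[OF finQ filter_Q]
        leads_boundary_cancel[OF low(1)] leads_boundary_cancel[OF low(2)]
      using True notQ by auto
  next
    case False
    then show ?thesis
      unfolding BD_iff_leads_boundary[OF fin filt] BD_iff_leads_boundary[OF finQ filter_Q]
        leads_boundary_cancel[OF low(1)] leads_boundary_cancel[OF low(2)]
      using same[of u p] s_less_t notQ t_in s_in
      by (auto simp: cells_Q)
  qed
  then show ?thesis by auto
qed

lemma notin_BD_cancel: "(s, t) \<notin> BD Q f"
  using BD_in_cells(1)[of s t Q f] by (auto simp: cells_Q)

end

section \<open>Existence of shallow orders and disjointness of pairs\<close>

lemma cells_cancel: "cells (cancel X \<phi>) = cells X - {fst \<phi>, snd \<phi>}"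
  by (simp add: cancel_def split: prod.split)

lemma shallow_cancellationI:
  "\<lbrakk>lefschetz_complex X; filter_on X f; \<phi> \<in> SH X f\<rbrakk> \<Longrightarrow> shallow_cancellation X f (fst \<phi>) (snd \<phi>)"
  by unfold_locales simp_all

lemma shallow_order_Cons:
  assumes "lefschetz_complex X" "filter_on X f"
  shows "shallow_order X f (\<phi> # \<Phi>) \<longleftrightarrow> \<phi> \<in> SH X f \<and> shallow_order (cancel X \<phi>) f \<Phi>"
proof (cases "\<phi> \<in> SH X f")
  case True
  interpret shallow_cancellation X f "fst \<phi>" "snd \<phi>"
    using assms True by (rule shallow_cancellationI)
  have "BD X f = insert \<phi> (BD (cancel X \<phi>) f)" "\<phi> \<notin> BD (cancel X \<phi>) f"
    using BD_cancel notin_BD_cancel by simp_all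
  then show ?thesis
    using True unfolding shallow_order_def by (auto simp: less_Suc_eq_0_disj)
next
  case False
  then show ?thesis by (auto simp: shallow_order_def)
qed

text \<open>
  A facet \<open>s\<close> of \<open>t\<close> for which \<open>f t - f s\<close> is smallest forms a shallow pair with \<open>t\<close>. So without
  shallow pairs the boundary matrix vanishes, and with it every reduced form.
\<close>
lemma SH_empty_imp_BD_empty:
  assumes "lefschetz_complex X" "filter_on X f" "SH X f = {}"
  shows "BD X f = {}"
proof -
  have fin: "finite (cells X)" using assms(1) by (rule lefschetz_finite)
  let ?F = "{(x, y). facet X x y}" and ?g = "\<lambda>(x, y). f y - f x"
  have nofacet: "\<not> facet X x y" for x y
  proof
    assume "facet X x y"
    have "finite ?F"
      by (rule finite_subset[of _ "cells X \<times> cells X"]) (auto simp: facet_def fin)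
    moreover have "?F \<noteq> {}" using \<open>facet X x y\<close> by blast
    ultimately have "Min (?g ` ?F) \<in> ?g ` ?F" by (blast intro: Min_in)
    then obtain p where p: "Min (?g ` ?F) = ?g p" "p \<in> ?F" by (rule imageE)
    obtain s t where st: "p = (s, t)" by (cases p)
    have min: "f t - f s \<le> f y - f x" if "facet X x y" for x y
    proof -
      have "Min (?g ` ?F) \<le> ?g (x, y)" using \<open>finite ?F\<close> that by (blast intro: Min_le)
      then show ?thesis unfolding p(1) st by simp
    qed
    have "facet X s t" using p(2) st by simp
    moreover have "f x \<le> f s" if "facet X x t" for x using min[OF that] by simp
    moreover have "f t \<le> f y" if "facet X s y" for y using min[OF that] by simp
    ultimately have "(s, t) \<in> SH X f" by (simp add: SH_def)
    with assms(3) show False by simp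
  qed
  have "False" if "(s, t) \<in> BD X f" for s t
  proof -
    obtain R where "reduced_form X f R" "is_pivot X f R s t" using \<open>(s, t) \<in> BD X f\<close>
      by (auto simp: BD_def)
    then obtain V where "(\<Sum>z\<in>cells X. boundary_matrix X s z * V z t) \<noteq> 0" "s \<in> cells X"
      unfolding reduced_form_def is_pivot_def by metis
    then show False using nofacet by (auto simp: boundary_matrix_def facet_def)
  qed
  then show ?thesis by auto
qed

lemma ex_shallow_order:
  "\<lbrakk>lefschetz_complex X; filter_on X f\<rbrakk> \<Longrightarrow> \<exists>\<Phi>. shallow_order X f \<Phi>"
proof (induction "card (cells X)" arbitrary: X rule: less_induct)
  case less
  show ?case
  proof (cases "SH X f = {}")
    case True
    then have "shallow_order X f []"
      using SH_empty_imp_BD_empty[OF less.prems] by (simp add: shallow_order_def)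
    then show ?thesis ..
  next
    case False
    then obtain \<phi> where \<phi>: "\<phi> \<in> SH X f" by blast
    interpret shallow_cancellation X f "fst \<phi>" "snd \<phi>"
      using less.prems \<phi> by (rule shallow_cancellationI)
    have "card (cells Q) < card (cells X)"
      by (rule psubset_card_mono) (use fin s_in in \<open>auto simp: cells_cancel\<close>)
    then obtain \<Phi> where "shallow_order Q f \<Phi>" using less.hyps lefschetz_Q filter_Q by blast
    then show ?thesis using shallow_order_Cons[OF lef filt] \<phi> by (metis prod.collapse)
  qed
qed

text \<open>
  Along a shallow order each cancelled pair takes its cells away, so that no later pair can use
  them again.
\<close>
lemma BD_disjoint:
  assumes "lefschetz_complex X" "filter_on X f"
    and "\<chi> \<in> BD X f" "\<xi> \<in> BD X f" "{fst \<chi>, snd \<chi>} \<inter> {fst \<xi>, snd \<xi>} \<noteq> {}"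
  shows "\<chi> = \<xi>"
proof -
  obtain \<Phi> where "shallow_order X f \<Phi>" using ex_shallow_order assms(1,2) by blast
  with assms show ?thesis
  proof (induction \<Phi> arbitrary: X)
    case Nil
    then show ?case by (simp add: shallow_order_def)
  next
    case (Cons \<phi> \<Phi>)
    then have \<phi>: "\<phi> \<in> SH X f" and ord: "shallow_order (cancel X \<phi>) f \<Phi>"
      using shallow_order_Cons by blast+
    interpret shallow_cancellation X f "fst \<phi>" "snd \<phi>"
      using Cons.prems(1,2) \<phi> by (rule shallow_cancellationI)
    have "fst \<psi> \<in> cells Q \<and> snd \<psi> \<in> cells Q" if "\<psi> \<in> BD Q f" for \<psi>
      using BD_in_cells[of "fst \<psi>" "snd \<psi>" Q f] that by simp
    moreover have "\<psi> = \<phi> \<or> \<psi> \<in> BD Q f" if "\<psi> \<in> BD X f" for \<psi>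
      using BD_cancel that by auto
    ultimately consider "\<chi> = \<phi>" "\<xi> = \<phi>" | "\<chi> \<in> BD Q f" "\<xi> \<in> BD Q f"
      using Cons.prems(3-5) by (fastforce simp: cells_cancel)
    then show ?case
      using Cons.IH[OF lefschetz_Q filter_Q] ord Cons.prems(5) by cases auto
  qed
qed

section \<open>Obstructions to shallowness\<close>

text \<open>
  The common pattern of the arguments below: \<open>Ob\<close> is an obstruction to the shallowness of
  \<open>(s, t)\<close> that only the cancellation of a pair satisfying \<open>K\<close> can destroy.
\<close>
lemma obstruction_cancelled_before:
  assumes "lefschetz_complex X" "filter_on X f" "shallow_order X f \<Phi>" "(s, t) \<in> set \<Phi>" "Ob X"
    and block: "\<And>Y. \<lbrakk>filter_on Y f; Ob Y\<rbrakk> \<Longrightarrow> (s, t) \<notin> SH Y f"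
    and persist: "\<And>Y a b. \<lbrakk>shallow_cancellation Y f a b; Ob Y; \<not> K (a, b)\<rbrakk>
        \<Longrightarrow> Ob (cancel Y (a, b))"
  shows "\<exists>\<Phi>1 \<Phi>2. \<Phi> = \<Phi>1 @ (s, t) # \<Phi>2 \<and> (\<exists>\<chi>\<in>set \<Phi>1. K \<chi>)"
  using assms(1-5)
proof (induction \<Phi> arbitrary: X)
  case Nil
  then show ?case by simp
next
  case (Cons \<phi> \<Phi>)
  then have \<phi>: "\<phi> \<in> SH X f" and ord: "shallow_order (cancel X \<phi>) f \<Phi>"
    using shallow_order_Cons by blast+
  interpret shallow_cancellation X f "fst \<phi>" "snd \<phi>"
    using Cons.prems(1,2) \<phi> by (rule shallow_cancellationI)
  have mem: "(s, t) \<in> set \<Phi>" using Cons.prems(4) block[OF filt Cons.prems(5)] \<phi> by auto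
  then obtain \<Phi>1 \<Phi>2 where split: "\<Phi> = \<Phi>1 @ (s, t) # \<Phi>2" by (meson split_list)
  have "\<exists>\<Phi>1 \<Phi>2. \<Phi> = \<Phi>1 @ (s, t) # \<Phi>2 \<and> (\<exists>\<chi>\<in>set \<Phi>1. K \<chi>)" if notK: "\<not> K \<phi>"
  proof -
    have "Ob Q" using persist[OF shallow_cancellation_axioms] Cons.prems(5) notK by simp
    then show ?thesis using Cons.IH[OF lefschetz_Q filter_Q] ord mem by simp
  qed
  then show ?case using split by (metis append_Cons list.set_intros(1) list.set_intros(2))
qed

text \<open>
  Cancelling \<open>(a, b)\<close> changes the facets of \<open>t\<close> only if \<open>a\<close> is one of them. Then it brings in
  facets of \<open>b\<close>, which lie at or below \<open>a\<close>, hence at or below \<open>x\<close>. It cannot remove \<open>x\<close> either: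
  if \<open>x\<close> were also a facet of \<open>b\<close>, it would lie at or below \<open>a\<close>, and \<open>a\<close> at or below \<open>x\<close>,
  which forces \<open>x = a\<close>.
\<close>
lemma top_facet_persists:
  assumes "shallow_cancellation X f a b"
    and "x \<noteq> a" "x \<noteq> b" "leading_cell X f (incid X t) x"
  shows "leading_cell (cancel X (a, b)) f (incid (cancel X (a, b)) t) x"
proof -
  interpret shallow_cancellation X f a b by fact
  have x: "x \<in> cells X" "incid X t x \<noteq> 0" "\<And>z. \<lbrakk>z \<in> cells X; incid X t z \<noteq> 0\<rbrakk> \<Longrightarrow> f z \<le> f x"
    using assms(4) by (auto simp: leading_cell_def)
  have "incid X t a = 0 \<or> incid X b x = 0"
    using x(3)[OF s_in] facet_t_le[OF x(1)] filter_inj[OF filt x(1) s_in] assms(2) by force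
  then have "incid Q t x \<noteq> 0" using x(2) by (auto simp: incid_Q)
  moreover have "f z \<le> f x" if "z \<in> cells Q" "incid Q t z \<noteq> 0" for z
  proof -
    have z: "z \<in> cells X" using that by (simp add: cells_Q)
    have "incid X t z \<noteq> 0 \<or> incid X t a \<noteq> 0 \<and> incid X b z \<noteq> 0" using that by (auto simp: incid_Q)
    then show ?thesis using x(3)[OF z] x(3)[OF s_in] facet_t_le[OF z] by auto
  qed
  ultimately show ?thesis using x(1) assms(2,3) by (auto simp: leading_cell_def cells_Q)
qed

text \<open>
  The dual statement. Reversing the sign of \<open>f\<close> turns the smallest cofacet into a leading cell.
\<close>
lemma bottom_cofacet_persists:
  assumes "shallow_cancellation X f a b"
    and "y \<noteq> a" "y \<noteq> b"
    and "leading_cell X (\<lambda>z. - f z) (\<lambda>z. incid X z s) y"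
  shows "leading_cell (cancel X (a, b)) (\<lambda>z. - f z) (\<lambda>z. incid (cancel X (a, b)) z s) y"
proof -
  interpret shallow_cancellation X f a b by fact
  have y: "y \<in> cells X" "incid X y s \<noteq> 0" "\<And>z. \<lbrakk>z \<in> cells X; incid X z s \<noteq> 0\<rbrakk> \<Longrightarrow> f y \<le> f z"
    using assms(4) by (auto simp: leading_cell_def)
  have "incid X y a = 0 \<or> incid X b s = 0"
    using y(3)[OF t_in] cofacet_s_ge[OF y(1)] filter_inj[OF filt y(1) t_in] assms(3) by force
  then have "incid Q y s \<noteq> 0" using y(2) by (auto simp: incid_Q)
  moreover have "f y \<le> f z" if "z \<in> cells Q" "incid Q z s \<noteq> 0" for z
  proof -
    have z: "z \<in> cells X" using that by (simp add: cells_Q)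
    have "incid X z s \<noteq> 0 \<or> incid X z a \<noteq> 0 \<and> incid X b s \<noteq> 0" using that by (auto simp: incid_Q)
    then show ?thesis using y(3)[OF z] y(3)[OF t_in] cofacet_s_ge[OF z] by auto
  qed
  ultimately show ?thesis using y(1) assms(2,3) by (auto simp: leading_cell_def cells_Q)
qed

lemma SH_iff_leading_cells:
  "(s, t) \<in> SH X f \<longleftrightarrow>
    leading_cell X f (incid X t) s \<and> leading_cell X (\<lambda>z. - f z) (\<lambda>z. incid X z s) t"
  by (auto simp: SH_def facet_def leading_cell_def)

lemma trailing_cell_unique:
  "\<lbrakk>filter_on X f; leading_cell X (\<lambda>z. - f z) c p; leading_cell X (\<lambda>z. - f z) c q\<rbrakk> \<Longrightarrow> p = q"
  unfolding leading_cell_def by (metis antisym filter_inj neg_le_iff_le)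

lemma cancelled_before_imp_not_minimal:
  assumes lef: "lefschetz_complex X" and filt: "filter_on X f" and \<phi>: "\<phi> \<in> BD X f"
    and x: "x \<noteq> fst \<phi>" "x \<noteq> snd \<phi>"
    and before: "\<And>\<Phi>. shallow_order X f \<Phi> \<Longrightarrow>
      \<exists>\<Phi>1 \<Phi>2. \<Phi> = \<Phi>1 @ \<phi> # \<Phi>2 \<and> (\<exists>\<chi>\<in>set \<Phi>1. x = fst \<chi> \<or> x = snd \<chi>)"
  shows "\<phi> \<notin> minimal_elements (BD X f) (depth_order X f)"
proof -
  obtain \<Phi>0 where \<Phi>0: "shallow_order X f \<Phi>0" using ex_shallow_order[OF lef filt] by blast
  then obtain \<Phi>1 \<Phi>2 \<chi>
    where "\<Phi>0 = \<Phi>1 @ \<phi> # \<Phi>2" "\<chi> \<in> set \<Phi>1" and \<chi>: "x = fst \<chi> \<or> x = snd \<chi>"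
    using before by blast
  then have \<chi>BD: "\<chi> \<in> BD X f" using \<Phi>0 by (auto simp: shallow_order_def)
  have "(\<chi>, \<phi>) \<in> list_order \<Phi>" if \<Phi>: "shallow_order X f \<Phi>" for \<Phi>
  proof -
    obtain \<Phi>1 \<Phi>2 \<xi> where split: "\<Phi> = \<Phi>1 @ \<phi> # \<Phi>2" and \<xi>: "\<xi> \<in> set \<Phi>1" "x = fst \<xi> \<or> x = snd \<xi>"
      using before[OF \<Phi>] by blast
    have "\<xi> \<in> BD X f" using \<Phi> split \<xi>(1) by (auto simp: shallow_order_def)
    then have "\<xi> = \<chi>" using BD_disjoint[OF lef filt _ \<chi>BD] \<xi>(2) \<chi> by blast
    then obtain i where i: "i < length \<Phi>1" "\<Phi>1 ! i = \<chi>" using \<xi>(1) by (auto simp: in_set_conv_nth)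
    then have "\<Phi> ! i = \<chi>" "\<Phi> ! length \<Phi>1 = \<phi>" "length \<Phi>1 < length \<Phi>"
      by (simp_all add: split nth_append)
    then show ?thesis using i unfolding list_order_def by (force intro: less_imp_le)
  qed
  then have "(\<chi>, \<phi>) \<in> depth_order X f" using \<chi>BD \<phi> by (simp add: depth_order_def)
  moreover have "\<chi> \<noteq> \<phi>" using x \<chi> by auto
  ultimately show ?thesis using \<chi>BD by (auto simp: minimal_elements_def)
qed

lemma nonshallow_not_minimal:
  assumes lef: "lefschetz_complex X" and filt: "filter_on X f"
    and BD: "(s, t) \<in> BD X f" and ns: "(s, t) \<notin> SH X f"
  shows "(s, t) \<notin> minimal_elements (BD X f) (depth_order X f)"
proof -
  have fin: "finite (cells X)" using lef by (rule lefschetz_finite)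
  have st: "s \<in> cells X" "t \<in> cells X" using BD_in_cells[OF BD] .
  have mem: "(s, t) \<in> set \<Phi>" if "shallow_order X f \<Phi>" for \<Phi>
    using that BD by (simp add: shallow_order_def)
  have diag: "incid X z z = 0" if "z \<in> cells X" for z
    using filter_less[OF filt, of z z] that by (auto simp: facet_def)
  \<comment> \<open>A cell without facets never acquires any, but \<open>(s, t)\<close> does become shallow eventually.\<close>
  obtain x where x: "leading_cell X f (incid X t) x"
  proof (rule ccontr)
    assume "\<not> thesis"
    then have none: "\<forall>x\<in>cells X. incid X t x = 0"
      using ex_leading_cell[OF fin, where c="incid X t" and f=f] that by blast
    obtain \<Phi> where \<Phi>: "shallow_order X f \<Phi>" using ex_shallow_order[OF lef filt] by blast
    let ?Ob = "\<lambda>Y::('a, 'b) cell_complex. \<forall>x\<in>cells Y. incid Y t x = 0"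
    have "\<exists>\<Phi>1 \<Phi>2. \<Phi> = \<Phi>1 @ (s, t) # \<Phi>2 \<and> (\<exists>\<chi>\<in>set \<Phi>1. False)"
    proof (rule obstruction_cancelled_before[OF lef filt \<Phi> mem[OF \<Phi>], where Ob = ?Ob])
      show "?Ob (cancel Y (a, b))" if "shallow_cancellation Y f a b" "?Ob Y" for Y a b
      proof -
        interpret shallow_cancellation Y f a b by fact
        show ?thesis using \<open>?Ob Y\<close> s_in by (auto simp: cells_Q incid_Q)
      qed
    qed (use none in \<open>auto simp: SH_def facet_def\<close>)
    then show False by blast
  qed
  show ?thesis
  proof (cases "x = s")
    case False
    have "x \<noteq> t" using x diag[OF st(2)] by (auto simp: leading_cell_def)
    show ?thesis
    proof (rule cancelled_before_imp_not_minimal[OF lef filt BD, of x])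
      fix \<Phi> assume \<Phi>: "shallow_order X f \<Phi>"
      show "\<exists>\<Phi>1 \<Phi>2. \<Phi> = \<Phi>1 @ (s, t) # \<Phi>2 \<and> (\<exists>\<chi>\<in>set \<Phi>1. x = fst \<chi> \<or> x = snd \<chi>)"
      proof (rule obstruction_cancelled_before[OF lef filt \<Phi> mem[OF \<Phi>],
            where Ob = "\<lambda>Y. leading_cell Y f (incid Y t) x"])
        show "(s, t) \<notin> SH Y f" if "filter_on Y f" "leading_cell Y f (incid Y t) x" for Y :: "('a, 'b) cell_complex"
          using that False leading_cell_unique SH_iff_leading_cells by metis
      qed (use x in \<open>auto intro: top_facet_persists\<close>)
    qed (use False \<open>x \<noteq> t\<close> in auto)
  next
    case True
    then have "incid X t s \<noteq> 0" using x by (simp add: leading_cell_def)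
    then obtain y where y: "leading_cell X (\<lambda>z. - f z) (\<lambda>z. incid X z s) y"
      using ex_leading_cell[OF fin st(2), of "\<lambda>z. incid X z s"] by blast
    have "y \<noteq> t" using ns x y True by (auto simp: SH_iff_leading_cells)
    have "y \<noteq> s" using y diag[OF st(1)] by (auto simp: leading_cell_def)
    show ?thesis
    proof (rule cancelled_before_imp_not_minimal[OF lef filt BD, of y])
      fix \<Phi> assume \<Phi>: "shallow_order X f \<Phi>"
      show "\<exists>\<Phi>1 \<Phi>2. \<Phi> = \<Phi>1 @ (s, t) # \<Phi>2 \<and> (\<exists>\<chi>\<in>set \<Phi>1. y = fst \<chi> \<or> y = snd \<chi>)"
      proof (rule obstruction_cancelled_before[OF lef filt \<Phi> mem[OF \<Phi>],
            where Ob = "\<lambda>Y. leading_cell Y (\<lambda>z. - f z) (\<lambda>z. incid Y z s) y"])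
        show "(s, t) \<notin> SH Y f" if "filter_on Y f" "leading_cell Y (\<lambda>z. - f z) (\<lambda>z. incid Y z s) y"
          for Y :: "('a, 'b) cell_complex"
          using that \<open>y \<noteq> t\<close> trailing_cell_unique SH_iff_leading_cells by metis
      qed (use y in \<open>auto intro: bottom_cofacet_persists\<close>)
    qed (use \<open>y \<noteq> s\<close> \<open>y \<noteq> t\<close> in auto)
  qed
qed

lemma shallow_minimal:
  assumes lef: "lefschetz_complex X" and filt: "filter_on X f" and \<phi>: "\<phi> \<in> SH X f"
  shows "\<phi> \<in> minimal_elements (BD X f) (depth_order X f)"
proof -
  interpret shallow_cancellation X f "fst \<phi>" "snd \<phi>"
    using lef filt \<phi> by (rule shallow_cancellationI)
  obtain \<Phi> where "shallow_order Q f \<Phi>" using ex_shallow_order[OF lefschetz_Q filter_Q] by blast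
  then have ord: "shallow_order X f (\<phi> # \<Phi>)" using shallow_order_Cons[OF lef filt] \<phi> by simp
  have "\<chi> = \<phi>" if "(\<chi>, \<phi>) \<in> depth_order X f" for \<chi>
  proof -
    have "(\<chi>, \<phi>) \<in> list_order (\<phi> # \<Phi>)" using that ord by (simp add: depth_order_def)
    then obtain i j where ij: "i \<le> j" "j < length (\<phi> # \<Phi>)"
      "(\<phi> # \<Phi>) ! i = \<chi>" "(\<phi> # \<Phi>) ! j = \<phi>" by (auto simp: list_order_def)
    moreover have "distinct (\<phi> # \<Phi>)" using ord by (simp add: shallow_order_def)
    ultimately have "j = 0" using nth_eq_iff_index_eq[of "\<phi> # \<Phi>" j 0] by simp
    then show ?thesis using ij by simp
  qed
  then show ?thesis using BD_cancel by (auto simp: minimal_elements_def)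
qed

theorem theorem7p5:
  fixes X :: "('a, 'k::field) cell_complex"
    and f :: "'a \<Rightarrow> real"
  assumes "lefschetz_complex X"
    and "filter_on X f"
  shows "SH X f = minimal_elements (BD X f) (depth_order X f)"
proof (rule set_eqI)
  fix \<phi> :: "'a \<times> 'a"
  show "\<phi> \<in> SH X f \<longleftrightarrow> \<phi> \<in> minimal_elements (BD X f) (depth_order X f)"
    using shallow_minimal[OF assms] nonshallow_not_minimal[OF assms]
    unfolding minimal_elements_def by (metis (no_types, lifting) mem_Collect_eq prod.collapse)
qed

end
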